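(* Let $(M^{2n+1},\varphi,\xi,\eta,g)$ be a $CR$-integrable almost $\alpha$-Kenmotsu manifold, with canonical connection $\widetilde\nabla$ and torsion $\widetilde T$. Then the following conditions are equivalent: a) $\widetilde\nabla\widetilde T=0$; b) $\widetilde\nabla h'=0$; c) the tensor field $h'$ is $\eta$-parallel and $\nabla_\xi h'=0$.
   Context: An almost contact metric manifold is a smooth manifold $M^{2n+1}$ with a $(1,1)$-tensor field $\varphi$, a vector field $\xi$, a $1$-form $\eta$ and a Riemannian metric $g$ satisfying $\varphi^2=-I+\eta\otimes\xi$, $\eta(\xi)=1$, $\varphi\xi=0$, $\eta\circ\varphi=0$, $g(\varphi X,\varphi Y)=g(X,Y)-\eta(X)\eta(Y)$. Put $\mathcal D=\ker\eta=\operatorname{Im}\varphi$ and $\Phi(X,Y)=g(X,\varphi Y)$. The structure is $CR$-integrable if the almost $CR$-structure $(\mathcal D,J)$, $J=\varphi|_{\mathcal D}$, is integrable. It is almost $\alpha$-Kenmotsu, with $\alpha$ a real constant, here $\alpha>0$, if $d\eta=0$ and $d\Phi=2\alpha\,\eta\wedge\Phi$. $\nabla$ is the Levi-Civita connection of $g$, $\mathcal L$ the Lie derivative, and $h'=\frac{1}{2\alpha}(\mathcal L_\xi\varphi)\circ\varphi$; this operator is symmetric, anticommutes with $\varphi$ and satisfies $h'\xi=0$. $h'$ is called $\eta$-parallel if $g((\nabla_Xh')Y,Z)=0$ for all $X,Y,Z$ orthogonal to $\xi$. The canonical connection of a $CR$-integrable almost $\alpha$-Kenmotsu manifold is the linear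 connection $\widetilde\nabla_XY=\nabla_XY+\alpha g(X+h'X,Y)\xi-\alpha\eta(Y)(X+h'X)$; its torsion $\widetilde T$ is normalized by $2\widetilde T(X,Y)=\widetilde\nabla_XY-\widetilde\nabla_YX-[X,Y]$. *)

theory Defs
  imports "HOL-Analysis.Analysis" "HOL-Library.Function_Algebras"
begin

section \<open>Smooth manifolds\<close>

text \<open>\<open>Ck k f S\<close> is meant for open \<open>S\<close> in a finite-dimensional space: all iterated directional
  derivatives of \<open>f\<close> up to order \<open>k\<close> exist and are continuous on \<open>S\<close>.\<close>

primrec Ck :: "nat \<Rightarrow> ('e::euclidean_space \<Rightarrow> 'f::real_normed_vector) \<Rightarrow> 'e set \<Rightarrow> bool" where
  "Ck 0 f S \<longleftrightarrow> continuous_on S f"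
| "Ck (Suc k) f S \<longleftrightarrow> (\<forall>x\<in>S. f differentiable (at x)) \<and>
     (\<forall>v. Ck k (\<lambda>x. frechet_derivative f (at x) v) S)"

definition smooth_on_open :: "('e::euclidean_space \<Rightarrow> 'f::real_normed_vector) \<Rightarrow> 'e set \<Rightarrow> bool" where
  "smooth_on_open f S \<longleftrightarrow> (\<forall>k. Ck k f S)"

type_synonym ('m, 'e) atlas = "('m set \<times> ('m \<Rightarrow> 'e)) set"

definition chart :: "'m::topological_space set \<Rightarrow> ('m \<Rightarrow> 'e::euclidean_space) \<Rightarrow> bool" where
  "chart U \<psi> \<longleftrightarrow> open U \<and> open (\<psi> ` U) \<and> homeomorphism U (\<psi> ` U) \<psi> (inv_into U \<psi>)"

text \<open>The manifold is the whole type \<open>'m\<close>, its model space is \<open>'e\<close>, so its dimension is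
  \<open>DIM('e)\<close>. The atlas need not be maximal.\<close>

definition smooth_manifold ::
  "('m::{t2_space,second_countable_topology}, 'e::euclidean_space) atlas \<Rightarrow> bool" where
  "smooth_manifold A \<longleftrightarrow>
     (\<forall>(U, \<psi>)\<in>A. chart U \<psi>) \<and> (\<Union>(U, \<psi>)\<in>A. U) = UNIV \<and>
     (\<forall>(U, \<psi>)\<in>A. \<forall>(V, \<theta>)\<in>A. smooth_on_open (\<theta> \<circ> inv_into U \<psi>) (\<psi> ` (U \<inter> V)))"

definition smooth_fun :: "('m, 'e::euclidean_space) atlas \<Rightarrow> ('m \<Rightarrow> real) \<Rightarrow> bool" where
  "smooth_fun A f \<longleftrightarrow> (\<forall>(U, \<psi>)\<in>A. smooth_on_open (f \<circ> inv_into U \<psi>) (\<psi> ` U))"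


section \<open>Tangent vectors and vector fields\<close>

type_synonym 'm tvec = "('m \<Rightarrow> real) \<Rightarrow> real"
type_synonym 'm vfield = "'m \<Rightarrow> 'm tvec"

text \<open>Tangent vectors at \<open>p\<close> are the derivations at \<open>p\<close> of the algebra of smooth functions. The last
  clause fixes their irrelevant values at non-smooth arguments, so that equality of tangent vectors
  is equality in HOL. Sums, differences and zero are the pointwise ones on function types.\<close>

definition tangent_space :: "('m, 'e::euclidean_space) atlas \<Rightarrow> 'm \<Rightarrow> 'm tvec set" where
  "tangent_space A p = {v.
     (\<forall>f h. smooth_fun A f \<longrightarrow> smooth_fun A h \<longrightarrow> v (\<lambda>q. f q + h q) = v f + v h) \<and>
     (\<forall>c f. smooth_fun A f \<longrightarrow> v (\<lambda>q. c * f q) = c * v f) \<and>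
     (\<forall>f h. smooth_fun A f \<longrightarrow> smooth_fun A h \<longrightarrow> v (\<lambda>q. f q * h q) = f p * v h + h p * v f) \<and>
     (\<forall>f. \<not> smooth_fun A f \<longrightarrow> v f = 0)}"

definition tscale :: "real \<Rightarrow> 'm tvec \<Rightarrow> 'm tvec" (infixr "\<cdot>\<^sub>t" 75) where
  "c \<cdot>\<^sub>t v = (\<lambda>f. c * v f)"

definition vscale :: "('m \<Rightarrow> real) \<Rightarrow> 'm vfield \<Rightarrow> 'm vfield" (infixr "\<cdot>\<^sub>v" 75) where
  "f \<cdot>\<^sub>v X = (\<lambda>p. f p \<cdot>\<^sub>t X p)"

definition vfields :: "('m, 'e::euclidean_space) atlas \<Rightarrow> 'm vfield set" where
  "vfields A = {X. (\<forall>p. X p \<in> tangent_space A p) \<and>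
     (\<forall>f. smooth_fun A f \<longrightarrow> smooth_fun A (\<lambda>p. X p f))}"

definition dirderiv :: "'m vfield \<Rightarrow> ('m \<Rightarrow> real) \<Rightarrow> 'm \<Rightarrow> real" where
  "dirderiv X f = (\<lambda>p. X p f)"

definition bracket :: "'m vfield \<Rightarrow> 'm vfield \<Rightarrow> 'm vfield" where
  "bracket X Y = (\<lambda>p f. X p (dirderiv Y f) - Y p (dirderiv X f))"


section \<open>Tensor fields\<close>

text \<open>Tensor fields are families of (multi)linear maps on the tangent spaces; they are smooth iff they
  take smooth vector fields to smooth vector fields resp. smooth functions. The operation below
  evaluates them on vector fields.\<close>

definition on_field :: "('m \<Rightarrow> 'a \<Rightarrow> 'b) \<Rightarrow> ('m \<Rightarrow> 'a) \<Rightarrow> 'm \<Rightarrow> 'b" (infixl "\<star>" 90) where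
  "S \<star> X = (\<lambda>p. S p (X p))"

definition endo_field :: "('m, 'e::euclidean_space) atlas \<Rightarrow> ('m \<Rightarrow> 'm tvec \<Rightarrow> 'm tvec) \<Rightarrow> bool" where
  "endo_field A S \<longleftrightarrow>
     (\<forall>p. \<forall>v\<in>tangent_space A p. S p v \<in> tangent_space A p \<and>
        (\<forall>w\<in>tangent_space A p. S p (v + w) = S p v + S p w) \<and>
        (\<forall>c. S p (c \<cdot>\<^sub>t v) = c \<cdot>\<^sub>t S p v)) \<and>
     (\<forall>X\<in>vfields A. S \<star> X \<in> vfields A)"

definition one_form :: "('m, 'e::euclidean_space) atlas \<Rightarrow> ('m \<Rightarrow> 'm tvec \<Rightarrow> real) \<Rightarrow> bool" where
  "one_form A \<omega> \<longleftrightarrow>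
     (\<forall>p. \<forall>v\<in>tangent_space A p.
        (\<forall>w\<in>tangent_space A p. \<omega> p (v + w) = \<omega> p v + \<omega> p w) \<and>
        (\<forall>c. \<omega> p (c \<cdot>\<^sub>t v) = c * \<omega> p v)) \<and>
     (\<forall>X\<in>vfields A. smooth_fun A (\<omega> \<star> X))"

definition riemannian_metric ::
  "('m, 'e::euclidean_space) atlas \<Rightarrow> ('m \<Rightarrow> 'm tvec \<Rightarrow> 'm tvec \<Rightarrow> real) \<Rightarrow> bool" where
  "riemannian_metric A g \<longleftrightarrow>
     (\<forall>p. \<forall>u\<in>tangent_space A p. \<forall>v\<in>tangent_space A p.
        g p u v = g p v u \<and>
        (\<forall>w\<in>tangent_space A p. g p (u + w) v = g p u v + g p w v) \<and>
        (\<forall>c. g p (c \<cdot>\<^sub>t u) v = c * g p u v)) \<and>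
     (\<forall>p. \<forall>v\<in>tangent_space A p. v \<noteq> 0 \<longrightarrow> g p v v > 0) \<and>
     (\<forall>X\<in>vfields A. \<forall>Y\<in>vfields A. smooth_fun A (g \<star> X \<star> Y))"

text \<open>Exterior derivatives and the wedge product, without combinatorial factors. With the other usual
  convention \<open>d\<close> on 2-forms and the wedge of a 1-form and a 2-form both acquire the factor 1/3, and
  \<open>d\<close> on 1-forms the factor 1/2, so the equations \<open>d\<eta> = 0\<close> and \<open>d\<Phi> = 2\<alpha> \<eta> \<and> \<Phi>\<close> are unaffected.
  2-forms are given by their action on vector fields.\<close>

definition ext_d1 :: "('m \<Rightarrow> 'm tvec \<Rightarrow> real) \<Rightarrow> 'm vfield \<Rightarrow> 'm vfield \<Rightarrow> 'm \<Rightarrow> real" where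
  "ext_d1 \<omega> X Y = dirderiv X (\<omega> \<star> Y) - dirderiv Y (\<omega> \<star> X) - \<omega> \<star> bracket X Y"

definition ext_d2 :: "('m vfield \<Rightarrow> 'm vfield \<Rightarrow> 'm \<Rightarrow> real) \<Rightarrow>
    'm vfield \<Rightarrow> 'm vfield \<Rightarrow> 'm vfield \<Rightarrow> 'm \<Rightarrow> real" where
  "ext_d2 \<Omega> X Y Z =
     dirderiv X (\<Omega> Y Z) + dirderiv Y (\<Omega> Z X) + dirderiv Z (\<Omega> X Y)
     - \<Omega> (bracket X Y) Z - \<Omega> (bracket Y Z) X - \<Omega> (bracket Z X) Y"

definition wedge12 :: "('m \<Rightarrow> 'm tvec \<Rightarrow> real) \<Rightarrow> ('m vfield \<Rightarrow> 'm vfield \<Rightarrow> 'm \<Rightarrow> real) \<Rightarrow>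
    'm vfield \<Rightarrow> 'm vfield \<Rightarrow> 'm vfield \<Rightarrow> 'm \<Rightarrow> real" where
  "wedge12 \<omega> \<Omega> X Y Z =
     (\<lambda>p. (\<omega> \<star> X) p * \<Omega> Y Z p + (\<omega> \<star> Y) p * \<Omega> Z X p + (\<omega> \<star> Z) p * \<Omega> X Y p)"

definition lie_deriv_endo :: "'m vfield \<Rightarrow> ('m \<Rightarrow> 'm tvec \<Rightarrow> 'm tvec) \<Rightarrow> 'm vfield \<Rightarrow> 'm vfield" where
  "lie_deriv_endo Z S X = bracket Z (S \<star> X) - S \<star> bracket Z X"


section \<open>Linear connections\<close>

type_synonym 'm connection = "'m vfield \<Rightarrow> 'm vfield \<Rightarrow> 'm vfield"

definition linear_connection :: "('m, 'e::euclidean_space) atlas \<Rightarrow> 'm connection \<Rightarrow> bool" where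
  "linear_connection A D \<longleftrightarrow>
     (\<forall>X\<in>vfields A. \<forall>Y\<in>vfields A. D X Y \<in> vfields A) \<and>
     (\<forall>X\<in>vfields A. \<forall>X'\<in>vfields A. \<forall>Y\<in>vfields A. D (X + X') Y = D X Y + D X' Y) \<and>
     (\<forall>f. \<forall>X\<in>vfields A. \<forall>Y\<in>vfields A. smooth_fun A f \<longrightarrow> D (f \<cdot>\<^sub>v X) Y = f \<cdot>\<^sub>v D X Y) \<and>
     (\<forall>X\<in>vfields A. \<forall>Y\<in>vfields A. \<forall>Y'\<in>vfields A. D X (Y + Y') = D X Y + D X Y') \<and>
     (\<forall>f. \<forall>X\<in>vfields A. \<forall>Y\<in>vfields A. smooth_fun A f \<longrightarrow>
        D X (f \<cdot>\<^sub>v Y) = dirderiv X f \<cdot>\<^sub>v Y + f \<cdot>\<^sub>v D X Y)"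

definition torsion :: "'m connection \<Rightarrow> 'm vfield \<Rightarrow> 'm vfield \<Rightarrow> 'm vfield" where
  "torsion D X Y = (\<lambda>p. 1 / 2) \<cdot>\<^sub>v (D X Y - D Y X - bracket X Y)"

definition levi_civita :: "('m, 'e::euclidean_space) atlas \<Rightarrow>
    ('m \<Rightarrow> 'm tvec \<Rightarrow> 'm tvec \<Rightarrow> real) \<Rightarrow> 'm connection \<Rightarrow> bool" where
  "levi_civita A g D \<longleftrightarrow> linear_connection A D \<and>
     (\<forall>X\<in>vfields A. \<forall>Y\<in>vfields A. torsion D X Y = 0) \<and>
     (\<forall>X\<in>vfields A. \<forall>Y\<in>vfields A. \<forall>Z\<in>vfields A.
        dirderiv X (g \<star> Y \<star> Z) = g \<star> D X Y \<star> Z + g \<star> Y \<star> D X Z)"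

definition cov_deriv_endo ::
  "'m connection \<Rightarrow> ('m vfield \<Rightarrow> 'm vfield) \<Rightarrow> 'm vfield \<Rightarrow> 'm vfield \<Rightarrow> 'm vfield" where
  "cov_deriv_endo D S X Y = D X (S Y) - S (D X Y)"

definition cov_deriv_bilin :: "'m connection \<Rightarrow> ('m vfield \<Rightarrow> 'm vfield \<Rightarrow> 'm vfield) \<Rightarrow>
    'm vfield \<Rightarrow> 'm vfield \<Rightarrow> 'm vfield \<Rightarrow> 'm vfield" where
  "cov_deriv_bilin D T X Y Z = D X (T Y Z) - T (D X Y) Z - T Y (D X Z)"

definition parallel_endo ::
  "('m, 'e::euclidean_space) atlas \<Rightarrow> 'm connection \<Rightarrow> ('m vfield \<Rightarrow> 'm vfield) \<Rightarrow> bool" where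
  "parallel_endo A D S \<longleftrightarrow> (\<forall>X\<in>vfields A. \<forall>Y\<in>vfields A. cov_deriv_endo D S X Y = 0)"

definition parallel_bilin :: "('m, 'e::euclidean_space) atlas \<Rightarrow> 'm connection \<Rightarrow>
    ('m vfield \<Rightarrow> 'm vfield \<Rightarrow> 'm vfield) \<Rightarrow> bool" where
  "parallel_bilin A D T \<longleftrightarrow>
     (\<forall>X\<in>vfields A. \<forall>Y\<in>vfields A. \<forall>Z\<in>vfields A. cov_deriv_bilin D T X Y Z = 0)"


section \<open>Almost contact metric and almost \<open>\<alpha>\<close>-Kenmotsu structures\<close>

definition almost_contact_metric :: "('m, 'e::euclidean_space) atlas \<Rightarrow>
    ('m \<Rightarrow> 'm tvec \<Rightarrow> 'm tvec) \<Rightarrow> 'm vfield \<Rightarrow> ('m \<Rightarrow> 'm tvec \<Rightarrow> real) \<Rightarrow>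
    ('m \<Rightarrow> 'm tvec \<Rightarrow> 'm tvec \<Rightarrow> real) \<Rightarrow> bool" where
  "almost_contact_metric A \<phi> \<xi> \<eta> g \<longleftrightarrow>
     endo_field A \<phi> \<and> \<xi> \<in> vfields A \<and> one_form A \<eta> \<and> riemannian_metric A g \<and>
     (\<forall>p. \<forall>v\<in>tangent_space A p. \<phi> p (\<phi> p v) = - v + \<eta> p v \<cdot>\<^sub>t \<xi> p) \<and>
     (\<forall>p. \<eta> p (\<xi> p) = 1) \<and>
     (\<forall>p. \<phi> p (\<xi> p) = 0) \<and>
     (\<forall>p. \<forall>v\<in>tangent_space A p. \<eta> p (\<phi> p v) = 0) \<and>
     (\<forall>p. \<forall>v\<in>tangent_space A p. \<forall>w\<in>tangent_space A p.
        g p (\<phi> p v) (\<phi> p w) = g p v w - \<eta> p v * \<eta> p w)"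

definition fundamental_form :: "('m \<Rightarrow> 'm tvec \<Rightarrow> 'm tvec) \<Rightarrow>
    ('m \<Rightarrow> 'm tvec \<Rightarrow> 'm tvec \<Rightarrow> real) \<Rightarrow> 'm vfield \<Rightarrow> 'm vfield \<Rightarrow> 'm \<Rightarrow> real" where
  "fundamental_form \<phi> g X Y = g \<star> X \<star> (\<phi> \<star> Y)"

definition contact_sections :: "('m, 'e::euclidean_space) atlas \<Rightarrow> ('m \<Rightarrow> 'm tvec \<Rightarrow> real) \<Rightarrow>
    'm vfield set" where
  "contact_sections A \<eta> = {X \<in> vfields A. \<eta> \<star> X = 0}"

text \<open>Integrability of the almost CR-structure \<open>(ker \<eta>, J)\<close> with \<open>J\<close> the restriction of \<open>\<phi>\<close>.\<close>

definition CR_integrable :: "('m, 'e::euclidean_space) atlas \<Rightarrow>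
    ('m \<Rightarrow> 'm tvec \<Rightarrow> 'm tvec) \<Rightarrow> ('m \<Rightarrow> 'm tvec \<Rightarrow> real) \<Rightarrow> bool" where
  "CR_integrable A \<phi> \<eta> \<longleftrightarrow>
     (\<forall>X\<in>contact_sections A \<eta>. \<forall>Y\<in>contact_sections A \<eta>.
        bracket (\<phi> \<star> X) (\<phi> \<star> Y) - bracket X Y \<in> contact_sections A \<eta> \<and>
        bracket (\<phi> \<star> X) (\<phi> \<star> Y) - bracket X Y
          = \<phi> \<star> (bracket (\<phi> \<star> X) Y + bracket X (\<phi> \<star> Y)))"

definition almost_kenmotsu :: "('m, 'e::euclidean_space) atlas \<Rightarrow> real \<Rightarrow>
    ('m \<Rightarrow> 'm tvec \<Rightarrow> 'm tvec) \<Rightarrow> 'm vfield \<Rightarrow> ('m \<Rightarrow> 'm tvec \<Rightarrow> real) \<Rightarrow>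
    ('m \<Rightarrow> 'm tvec \<Rightarrow> 'm tvec \<Rightarrow> real) \<Rightarrow> bool" where
  "almost_kenmotsu A \<alpha> \<phi> \<xi> \<eta> g \<longleftrightarrow> almost_contact_metric A \<phi> \<xi> \<eta> g \<and>
     (\<forall>X\<in>vfields A. \<forall>Y\<in>vfields A. ext_d1 \<eta> X Y = 0) \<and>
     (\<forall>X\<in>vfields A. \<forall>Y\<in>vfields A. \<forall>Z\<in>vfields A.
        ext_d2 (fundamental_form \<phi> g) X Y Z
          = (\<lambda>p. 2 * \<alpha> * wedge12 \<eta> (fundamental_form \<phi> g) X Y Z p))"

definition h_prime :: "real \<Rightarrow> ('m \<Rightarrow> 'm tvec \<Rightarrow> 'm tvec) \<Rightarrow> 'm vfield \<Rightarrow> 'm vfield \<Rightarrow> 'm vfield" where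
  "h_prime \<alpha> \<phi> \<xi> X = (\<lambda>p. 1 / (2 * \<alpha>)) \<cdot>\<^sub>v lie_deriv_endo \<xi> \<phi> (\<phi> \<star> X)"

definition eta_parallel :: "('m, 'e::euclidean_space) atlas \<Rightarrow>
    ('m \<Rightarrow> 'm tvec \<Rightarrow> 'm tvec \<Rightarrow> real) \<Rightarrow> 'm vfield \<Rightarrow> 'm connection \<Rightarrow>
    ('m vfield \<Rightarrow> 'm vfield) \<Rightarrow> bool" where
  "eta_parallel A g \<xi> D S \<longleftrightarrow>
     (\<forall>X\<in>vfields A. \<forall>Y\<in>vfields A. \<forall>Z\<in>vfields A.
        g \<star> X \<star> \<xi> = 0 \<longrightarrow> g \<star> Y \<star> \<xi> = 0 \<longrightarrow> g \<star> Z \<star> \<xi> = 0 \<longrightarrow>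
        g \<star> cov_deriv_endo D S X Y \<star> Z = 0)"

definition canonical_connection :: "real \<Rightarrow> ('m \<Rightarrow> 'm tvec \<Rightarrow> 'm tvec) \<Rightarrow> 'm vfield \<Rightarrow>
    ('m \<Rightarrow> 'm tvec \<Rightarrow> real) \<Rightarrow> ('m \<Rightarrow> 'm tvec \<Rightarrow> 'm tvec \<Rightarrow> real) \<Rightarrow>
    'm connection \<Rightarrow> 'm connection" where
  "canonical_connection \<alpha> \<phi> \<xi> \<eta> g D X Y =
     D X Y + (\<lambda>p. \<alpha> * (g \<star> (X + h_prime \<alpha> \<phi> \<xi> X) \<star> Y) p) \<cdot>\<^sub>v \<xi>
       - (\<lambda>p. \<alpha> * (\<eta> \<star> Y) p) \<cdot>\<^sub>v (X + h_prime \<alpha> \<phi> \<xi> X)"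

end

theory Submission
  imports Defs
begin

text \<open>Everything is governed by the operator \<open>B X = \<nabla>\<^sub>X \<xi>\<close>. Since \<open>\<eta> = g(\<cdot>, \<xi>)\<close> is closed, \<open>B\<close> is
  symmetric, and since \<open>\<xi>\<close> has unit length, \<open>B\<close> takes values in \<open>ker \<eta>\<close>; hence \<open>B \<xi> = 0\<close>.
  Contracting \<open>d\<Phi> = 2\<alpha> \<eta> \<and> \<Phi>\<close> with \<open>\<xi>\<close> says that the Lie derivative of \<open>\<Phi>\<close> along \<open>\<xi>\<close> is \<open>2\<alpha> \<Phi>\<close>.
  As \<open>\<Phi>\<close> is \<open>g(\<cdot>, \<phi> \<cdot>)\<close> and the Lie derivative of \<open>g\<close> along \<open>\<xi>\<close> is \<open>2 g(B \<cdot>, \<cdot>)\<close>, the Lie derivative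
  of \<open>\<phi>\<close> is \<open>2\<alpha> \<phi> - 2 B \<phi>\<close> (\<open>lie_deriv_phi\<close>). Composing with \<open>\<phi>\<close> expresses \<open>h'\<close> through \<open>B\<close>:
  \<open>h' = B / \<alpha> - I + \<eta> \<otimes> \<xi>\<close> (\<open>h_prime_shape\<close>). In particular \<open>h'\<close> is symmetric, \<open>h' \<xi> = 0\<close> and
  \<open>\<eta> \<circ> h' = 0\<close>.

  The same formula, read as \<open>B = \<alpha> (I + h') - \<alpha> \<eta> \<otimes> \<xi>\<close>, shows that the canonical connection \<open>D\<close>
  makes \<open>\<xi>\<close> parallel; it is also metric, so \<open>\<eta>\<close> is parallel too. By the symmetry of \<open>h'\<close>, twice its
  torsion is \<open>\<alpha> (\<eta> \<otimes> K - K \<otimes> \<eta>)\<close> with \<open>K = I + h'\<close>. Differentiating, only \<open>D h'\<close> survives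
  (\<open>cov_deriv_torsion_nabla_can\<close>): a parallel \<open>h'\<close> gives parallel torsion, and conversely inserting
  \<open>\<xi>\<close> into the torsion recovers \<open>D h'\<close>.

  Finally \<open>D h'\<close> and \<open>\<nabla> h'\<close> differ by a term along \<open>\<xi>\<close> and a term containing \<open>\<eta>(Y)\<close>
  (\<open>cov_deriv_h_prime_can\<close>). They therefore have the same components orthogonal to \<open>\<xi>\<close>, and they
  agree in the direction \<open>\<xi>\<close>. All other components of \<open>D h'\<close> vanish identically because \<open>\<xi>\<close> and
  \<open>\<eta>\<close> are \<open>D\<close>-parallel and are annihilated by \<open>h'\<close>. So the vanishing of \<open>D h'\<close> amounts to
  \<open>\<eta>\<close>-parallelism together with \<open>\<nabla>\<^sub>\<xi> h' = 0\<close>.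

  The argument uses global vector fields throughout. Tensor identities can be tested on them, because
  a field orthogonal to every field is orthogonal to itself and hence zero.\<close>

section \<open>The algebra of smooth functions\<close>

text \<open>Openness of \<open>S\<close> matters: the iterated derivatives at a point of \<open>S\<close> depend on the function in
  a neighbourhood.\<close>

lemma Ck_cong:
  assumes "open S" "\<And>x. x \<in> S \<Longrightarrow> f x = h x" "Ck k f S"
  shows "Ck k h S"
  using assms(2,3)
proof (induction k arbitrary: f h)
  case 0
  then show ?case
    using continuous_on_cong by (metis Ck.simps(1))
next
  case (Suc k)
  have diff: "f differentiable (at x)" if "x \<in> S" for x
    using Suc.prems(2) that by simp
  have "h differentiable (at x)" if x: "x \<in> S" for x
  proof -
    obtain D where "(f has_derivative D) (at x)"
      using diff[OF x] unfolding differentiable_def by blast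
    from has_derivative_transform_within_open[OF this \<open>open S\<close> x Suc.prems(1)]
    show ?thesis unfolding differentiable_def by blast
  qed
  moreover have "Ck k (\<lambda>x. frechet_derivative h (at x) v) S" for v
  proof (rule Suc.IH)
    show "frechet_derivative f (at x) v = frechet_derivative h (at x) v" if "x \<in> S" for x
      using frechet_derivative_transform_within_open[OF diff[OF that] \<open>open S\<close> that Suc.prems(1)]
      by simp
    show "Ck k (\<lambda>x. frechet_derivative f (at x) v) S"
      using Suc.prems(2) by simp
  qed
  ultimately show ?case by simp
qed

lemma Ck_Suc_imp_Ck: "Ck (Suc k) f S \<Longrightarrow> Ck k f S"
proof (induction k arbitrary: f)
  case 0
  then show ?case
    by (simp add: continuous_at_imp_continuous_on differentiable_imp_continuous_within)
next
  case (Suc k)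
  then show ?case by (metis Ck.simps(2))
qed

lemma Ck_const: "Ck k (\<lambda>x. c) S"
  by (induction k arbitrary: c) simp_all

lemma Ck_add:
  assumes "open S" "Ck k f S" "Ck k h S"
  shows "Ck k (\<lambda>x. f x + h x) S"
  using assms(2,3)
proof (induction k arbitrary: f h)
  case 0
  then show ?case by (simp add: continuous_on_add)
next
  case (Suc k)
  have "Ck k (\<lambda>x. frechet_derivative (\<lambda>y. f y + h y) (at x) v) S" for v
  proof (rule Ck_cong[OF \<open>open S\<close>])
    show "Ck k (\<lambda>x. frechet_derivative f (at x) v + frechet_derivative h (at x) v) S"
      using Suc.prems by (intro Suc.IH) simp_all
    show "frechet_derivative f (at x) v + frechet_derivative h (at x) v
        = frechet_derivative (\<lambda>y. f y + h y) (at x) v" if "x \<in> S" for x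
    proof -
      have "((\<lambda>y. f y + h y) has_derivative
          (\<lambda>v. frechet_derivative f (at x) v + frechet_derivative h (at x) v)) (at x)"
        using Suc.prems that by (intro has_derivative_add) (simp_all add: frechet_derivative_works)
      from frechet_derivative_at[OF this] show ?thesis
        by metis
    qed
  qed
  then show ?case using Suc.prems by simp
qed

lemma Ck_mult:
  fixes f h :: "'e::euclidean_space \<Rightarrow> real"
  assumes "open S" "Ck k f S" "Ck k h S"
  shows "Ck k (\<lambda>x. f x * h x) S"
  using assms(2,3)
proof (induction k arbitrary: f h)
  case 0
  then show ?case by (simp add: continuous_on_mult)
next
  case (Suc k)
  have Ck_lower: "Ck k f S" "Ck k h S"
    using Suc.prems Ck_Suc_imp_Ck by blast+
  have "Ck k (\<lambda>x. frechet_derivative (\<lambda>y. f y * h y) (at x) v) S" for v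
  proof (rule Ck_cong[OF \<open>open S\<close>])
    show "Ck k (\<lambda>x. f x * frechet_derivative h (at x) v + frechet_derivative f (at x) v * h x) S"
      using Suc.prems Ck_lower by (intro Ck_add[OF \<open>open S\<close>] Suc.IH) simp_all
    show "f x * frechet_derivative h (at x) v + frechet_derivative f (at x) v * h x
        = frechet_derivative (\<lambda>y. f y * h y) (at x) v" if "x \<in> S" for x
    proof -
      have "((\<lambda>y. f y * h y) has_derivative
          (\<lambda>v. f x * frechet_derivative h (at x) v + frechet_derivative f (at x) v * h x)) (at x)"
        using Suc.prems that by (intro has_derivative_mult) (simp_all add: frechet_derivative_works)
      from frechet_derivative_at[OF this] show ?thesis
        by metis
    qed
  qed
  then show ?case using Suc.prems by (simp add: differentiable_mult)
qed

lemma smooth_fun_const: "smooth_fun A (\<lambda>q. c)"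
  by (auto simp: smooth_fun_def smooth_on_open_def comp_def Ck_const)

lemma smooth_manifold_chart_open:
  "smooth_manifold A \<Longrightarrow> (U, \<psi>) \<in> A \<Longrightarrow> open (\<psi> ` U)"
  by (auto simp: smooth_manifold_def chart_def)

lemma smooth_fun_add:
  assumes "smooth_manifold A" "smooth_fun A f" "smooth_fun A h"
  shows "smooth_fun A (\<lambda>q. f q + h q)"
  using assms smooth_manifold_chart_open[OF assms(1)]
  by (fastforce simp: smooth_fun_def smooth_on_open_def comp_def intro!: Ck_add)

lemma smooth_fun_mult:
  assumes "smooth_manifold A" "smooth_fun A f" "smooth_fun A h"
  shows "smooth_fun A (\<lambda>q. f q * h q)"
  using assms smooth_manifold_chart_open[OF assms(1)]
  by (fastforce simp: smooth_fun_def smooth_on_open_def comp_def intro!: Ck_mult)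

section \<open>The module of vector fields\<close>

lemma tangent_space_add:
  "v \<in> tangent_space A p \<Longrightarrow> w \<in> tangent_space A p \<Longrightarrow> v + w \<in> tangent_space A p"
  by (auto simp: tangent_space_def algebra_simps)

lemma tangent_space_tscale: "v \<in> tangent_space A p \<Longrightarrow> c \<cdot>\<^sub>t v \<in> tangent_space A p"
  by (auto simp: tangent_space_def tscale_def algebra_simps)

lemma tangent_space_zero: "0 \<in> tangent_space A p"
  by (auto simp: tangent_space_def)

lemma tangent_vector_add:
  "v \<in> tangent_space A p \<Longrightarrow> smooth_fun A f \<Longrightarrow> smooth_fun A h \<Longrightarrow> v (\<lambda>q. f q + h q) = v f + v h"
  by (simp add: tangent_space_def)

lemma tangent_vector_scale:
  "v \<in> tangent_space A p \<Longrightarrow> smooth_fun A f \<Longrightarrow> v (\<lambda>q. c * f q) = c * v f"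
  by (simp add: tangent_space_def)

lemma tangent_vector_mult:
  "v \<in> tangent_space A p \<Longrightarrow> smooth_fun A f \<Longrightarrow> smooth_fun A h \<Longrightarrow>
    v (\<lambda>q. f q * h q) = f p * v h + h p * v f"
  by (simp add: tangent_space_def)

lemma tangent_vector_not_smooth: "v \<in> tangent_space A p \<Longrightarrow> \<not> smooth_fun A f \<Longrightarrow> v f = 0"
  by (simp add: tangent_space_def)

text \<open>The product rule for \<open>1 \<cdot> 1\<close> forces \<open>v(1) = 2 v(1)\<close>.\<close>

lemma tangent_vector_const:
  assumes "v \<in> tangent_space A p"
  shows "v (\<lambda>q. c) = 0"
  using tangent_vector_mult[OF assms smooth_fun_const[of A 1] smooth_fun_const[of A 1]]
    tangent_vector_scale[OF assms smooth_fun_const[of A 1], of c] by simp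

lemma vfields_tangent: "X \<in> vfields A \<Longrightarrow> X p \<in> tangent_space A p"
  by (simp add: vfields_def)

lemma vfields_smooth: "X \<in> vfields A \<Longrightarrow> smooth_fun A f \<Longrightarrow> smooth_fun A (dirderiv X f)"
  by (simp add: vfields_def dirderiv_def)

lemma vfields_zero: "0 \<in> vfields A"
  by (simp add: vfields_def tangent_space_zero smooth_fun_const)

lemma vfields_add:
  assumes "smooth_manifold A" "X \<in> vfields A" "Y \<in> vfields A"
  shows "X + Y \<in> vfields A"
  using assms by (simp add: vfields_def tangent_space_add smooth_fun_add)

lemma vfields_vscale:
  assumes "smooth_manifold A" "smooth_fun A f" "X \<in> vfields A"
  shows "f \<cdot>\<^sub>v X \<in> vfields A"
  using assms by (simp add: vfields_def vscale_def tangent_space_tscale)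
    (simp add: tscale_def smooth_fun_mult)

lemma vfields_uminus:
  assumes "smooth_manifold A" "X \<in> vfields A"
  shows "- X \<in> vfields A"
proof -
  have "- X = (\<lambda>p. - 1) \<cdot>\<^sub>v X"
    by (simp add: fun_eq_iff vscale_def tscale_def)
  then show ?thesis
    using vfields_vscale[OF assms(1) smooth_fun_const assms(2)] by metis
qed

lemma vfields_diff:
  assumes "smooth_manifold A" "X \<in> vfields A" "Y \<in> vfields A"
  shows "X - Y \<in> vfields A"
  using vfields_add[OF assms(1,2) vfields_uminus[OF assms(1,3)]] by simp

lemma dirderiv_add:
  assumes "X \<in> vfields A" "smooth_fun A f" "smooth_fun A h"
  shows "dirderiv X (\<lambda>q. f q + h q) = (\<lambda>q. dirderiv X f q + dirderiv X h q)"
  unfolding dirderiv_def using tangent_vector_add[OF vfields_tangent[OF assms(1)] assms(2,3)] by simp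

lemma dirderiv_mult:
  assumes "X \<in> vfields A" "smooth_fun A f" "smooth_fun A h"
  shows "dirderiv X (\<lambda>q. f q * h q) = (\<lambda>q. f q * dirderiv X h q + h q * dirderiv X f q)"
  unfolding dirderiv_def using tangent_vector_mult[OF vfields_tangent[OF assms(1)] assms(2,3)] by simp

lemma dirderiv_scale:
  assumes "X \<in> vfields A" "smooth_fun A f"
  shows "dirderiv X (\<lambda>q. c * f q) = (\<lambda>q. c * dirderiv X f q)"
  unfolding dirderiv_def using tangent_vector_scale[OF vfields_tangent[OF assms(1)] assms(2)] by simp

lemma dirderiv_const: "X \<in> vfields A \<Longrightarrow> dirderiv X (\<lambda>q. c) = 0"
  unfolding dirderiv_def by (auto simp: fun_eq_iff intro: tangent_vector_const vfields_tangent)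

lemma dirderiv_zero: "X \<in> vfields A \<Longrightarrow> dirderiv X 0 = 0"
  using dirderiv_const[of X A 0] by (simp add: zero_fun_def)

lemma smooth_fun_diff:
  assumes "smooth_manifold A" "smooth_fun A f" "smooth_fun A h"
  shows "smooth_fun A (\<lambda>q. f q - h q)"
  using smooth_fun_add[OF assms(1,2)
      smooth_fun_mult[OF assms(1) smooth_fun_const[of _ "-1"] assms(3)]]
  by simp

text \<open>In the product rule for the commutator, the mixed terms \<open>X(f) Y(h) + X(h) Y(f)\<close> are symmetric
  in \<open>X\<close> and \<open>Y\<close> and cancel.\<close>

lemma bracket_vfields:
  assumes man: "smooth_manifold A" and X: "X \<in> vfields A" and Y: "Y \<in> vfields A"
  shows "bracket X Y \<in> vfields A"
proof -
  note smooth = vfields_smooth[OF X] vfields_smooth[OF Y]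
  note tX = vfields_tangent[OF X] and tY = vfields_tangent[OF Y]
  have "bracket X Y p \<in> tangent_space A p" for p
    unfolding tangent_space_def
  proof (intro CollectI conjI allI impI)
    fix f h assume f: "smooth_fun A f" and h: "smooth_fun A h"
    show "bracket X Y p (\<lambda>q. f q + h q) = bracket X Y p f + bracket X Y p h"
      by (simp add: bracket_def dirderiv_add[OF X f h] dirderiv_add[OF Y f h]
          tangent_vector_add[OF tX] tangent_vector_add[OF tY] smooth f h)
    show "bracket X Y p (\<lambda>q. f q * h q) = f p * bracket X Y p h + h p * bracket X Y p f"
      using man by (simp add: bracket_def dirderiv_mult[OF X f h] dirderiv_mult[OF Y f h]
          tangent_vector_add[OF tX] tangent_vector_add[OF tY] tangent_vector_mult[OF tX]
          tangent_vector_mult[OF tY] smooth f h smooth_fun_mult)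
        (simp add: dirderiv_def algebra_simps)
  next
    fix c f assume f: "smooth_fun A f"
    show "bracket X Y p (\<lambda>q. c * f q) = c * bracket X Y p f"
      by (simp add: bracket_def dirderiv_scale[OF X f] dirderiv_scale[OF Y f]
          tangent_vector_scale[OF tX] tangent_vector_scale[OF tY] smooth f algebra_simps)
  next
    fix f assume "\<not> smooth_fun A f"
    \<comment> \<open>Tangent vectors take the value 0 at non-smooth functions, so the inner derivative is the zero
      function, which is smooth, and the outer derivative sends it to 0.\<close>
    then have "dirderiv X f = (\<lambda>q. 0)" "dirderiv Y f = (\<lambda>q. 0)"
      using tangent_vector_not_smooth[OF tX] tangent_vector_not_smooth[OF tY]
      by (simp_all add: dirderiv_def)
    then show "bracket X Y p f = 0"
      by (simp add: bracket_def tangent_vector_const[OF tX] tangent_vector_const[OF tY])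
  qed
  moreover have "smooth_fun A (\<lambda>p. bracket X Y p f)" if f: "smooth_fun A f" for f
    using smooth_fun_diff[OF man smooth(1)[OF smooth(2)[OF f]] smooth(2)[OF smooth(1)[OF f]]]
    by (simp add: bracket_def dirderiv_def)
  ultimately show ?thesis by (simp add: vfields_def)
qed

lemma vscale_uminus_one: "(\<lambda>p. - 1) \<cdot>\<^sub>v X = - X"
  by (simp add: fun_eq_iff vscale_def tscale_def)

section \<open>Linear connections and tensorial operators\<close>

text \<open>Linearity over the smooth functions: the operators on fields that come from endomorphism fields.
  The operator \<open>h'\<close> and covariant derivatives are given on fields only, so this is the form in which
  their tensoriality is available.\<close>

definition field_linear :: "('m, 'e::euclidean_space) atlas \<Rightarrow> ('m vfield \<Rightarrow> 'm vfield) \<Rightarrow> bool" where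
  "field_linear A S \<longleftrightarrow>
     (\<forall>X\<in>vfields A. S X \<in> vfields A) \<and>
     (\<forall>X\<in>vfields A. \<forall>Y\<in>vfields A. S (X + Y) = S X + S Y) \<and>
     (\<forall>f. \<forall>X\<in>vfields A. smooth_fun A f \<longrightarrow> S (f \<cdot>\<^sub>v X) = f \<cdot>\<^sub>v S X)"

lemma field_linear_uminus:
  assumes "field_linear A S" "X \<in> vfields A"
  shows "S (- X) = - S X"
  using assms smooth_fun_const[of A "-1"] unfolding field_linear_def
  by (metis vscale_uminus_one)

lemma field_linear_diff:
  assumes "smooth_manifold A" "field_linear A S" "X \<in> vfields A" "Y \<in> vfields A"
  shows "S (X - Y) = S X - S Y"
proof -
  have "S (X + - Y) = S X + S (- Y)"
    using assms vfields_uminus unfolding field_linear_def by blast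
  then show ?thesis using field_linear_uminus[OF assms(2,4)] by simp
qed

lemma field_linear_endo_field:
  assumes "endo_field A S"
  shows "field_linear A (\<lambda>X. S \<star> X)"
  using assms
  by (auto simp: field_linear_def endo_field_def on_field_def vscale_def vfields_tangent fun_eq_iff)

lemma linear_connection_field_linear:
  assumes "linear_connection A D" "Y \<in> vfields A"
  shows "field_linear A (\<lambda>X. D X Y)"
  using assms by (simp add: linear_connection_def field_linear_def)

lemma linear_connection_uminus_right:
  assumes D: "linear_connection A D" and XY: "X \<in> vfields A" "Y \<in> vfields A"
  shows "D X (- Y) = - D X Y"
proof -
  have "D X ((\<lambda>p. - 1) \<cdot>\<^sub>v Y) = dirderiv X (\<lambda>p. - 1) \<cdot>\<^sub>v Y + (\<lambda>p. - 1) \<cdot>\<^sub>v D X Y"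
    using D XY smooth_fun_const[of A "-1"] unfolding linear_connection_def by blast
  then show ?thesis
    by (simp only: vscale_uminus_one dirderiv_const[OF XY(1)])
      (simp add: fun_eq_iff vscale_def tscale_def)
qed

lemma linear_connection_diff_right:
  assumes "smooth_manifold A" "linear_connection A D"
    and "X \<in> vfields A" "Y \<in> vfields A" "Z \<in> vfields A"
  shows "D X (Y - Z) = D X Y - D X Z"
proof -
  have "D X (Y + - Z) = D X Y + D X (- Z)"
    using assms vfields_uminus unfolding linear_connection_def by blast
  then show ?thesis using linear_connection_uminus_right[OF assms(2,3,5)] by simp
qed

lemma field_linear_cov_deriv_direction:
  assumes man: "smooth_manifold A" and D: "linear_connection A D"
    and S: "field_linear A S" and Y: "Y \<in> vfields A"
  shows "field_linear A (\<lambda>X. cov_deriv_endo D S X Y)"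
proof -
  have SY: "S Y \<in> vfields A"
    using S Y by (simp add: field_linear_def)
  note DY = linear_connection_field_linear[OF D Y] and DSY = linear_connection_field_linear[OF D SY]
  have "S (D (X + X') Y) = S (D X Y) + S (D X' Y)" "S (D (f \<cdot>\<^sub>v X) Y) = f \<cdot>\<^sub>v S (D X Y)"
    if "X \<in> vfields A" "X' \<in> vfields A" "smooth_fun A f" for X X' f
    using S DY that by (simp_all add: field_linear_def)
  then show ?thesis
    using S DY DSY man
    by (simp add: field_linear_def cov_deriv_endo_def vfields_diff)
      (auto simp: fun_eq_iff vscale_def tscale_def algebra_simps)
qed

text \<open>The Leibniz terms \<open>X(f) S Y\<close> produced by the two summands of \<open>(D\<^sub>X S) Y\<close> cancel.\<close>

lemma field_linear_cov_deriv_endo: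
  assumes man: "smooth_manifold A" and D: "linear_connection A D"
    and S: "field_linear A S" and X: "X \<in> vfields A"
  shows "field_linear A (cov_deriv_endo D S X)"
proof -
  have closed: "S Y \<in> vfields A" "D X Y \<in> vfields A" if "Y \<in> vfields A" for Y
    using S D X that by (simp_all add: field_linear_def linear_connection_def)
  have "S (D X (f \<cdot>\<^sub>v Y)) = dirderiv X f \<cdot>\<^sub>v S Y + f \<cdot>\<^sub>v S (D X Y)"
    if "Y \<in> vfields A" "smooth_fun A f" for f Y
    using S D X that closed vfields_smooth[OF X] vfields_vscale[OF man]
    by (simp add: field_linear_def linear_connection_def)
  then show ?thesis
    using S D X closed man
    by (simp add: field_linear_def linear_connection_def cov_deriv_endo_def vfields_diff)
      (auto simp: fun_eq_iff vscale_def tscale_def algebra_simps)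
qed

section \<open>Riemannian metric and Levi-Civita connection\<close>

locale riemannian_manifold =
  fixes A :: "('m::{t2_space,second_countable_topology}, 'e::euclidean_space) atlas"
    and g :: "'m \<Rightarrow> 'm tvec \<Rightarrow> 'm tvec \<Rightarrow> real"
    and nabla :: "'m connection"
  assumes manifold: "smooth_manifold A"
    and metric: "riemannian_metric A g"
    and levi_civita: "levi_civita A g nabla"
begin

lemmas [simp] = smooth_fun_const smooth_fun_mult[OF manifold] smooth_fun_add[OF manifold]
  smooth_fun_diff[OF manifold] vfields_zero vfields_add[OF manifold] vfields_diff[OF manifold]
  vfields_uminus[OF manifold] vfields_vscale[OF manifold] bracket_vfields[OF manifold]
  vfields_smooth

lemma linear_connection_nabla: "linear_connection A nabla"
  using levi_civita by (simp add: levi_civita_def)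

lemma smooth_metric [simp]: "X \<in> vfields A \<Longrightarrow> Y \<in> vfields A \<Longrightarrow> smooth_fun A (g \<star> X \<star> Y)"
  using metric by (simp add: riemannian_metric_def)

lemma metric_sym: "X \<in> vfields A \<Longrightarrow> Y \<in> vfields A \<Longrightarrow> g \<star> X \<star> Y = g \<star> Y \<star> X"
  using metric by (simp add: riemannian_metric_def on_field_def fun_eq_iff vfields_tangent)

lemma metric_add_left:
  "X \<in> vfields A \<Longrightarrow> Y \<in> vfields A \<Longrightarrow> Z \<in> vfields A \<Longrightarrow> g \<star> (X + Y) \<star> Z = g \<star> X \<star> Z + g \<star> Y \<star> Z"
  using metric by (simp add: riemannian_metric_def on_field_def fun_eq_iff vfields_tangent)

lemma metric_vscale_left:
  "X \<in> vfields A \<Longrightarrow> Z \<in> vfields A \<Longrightarrow> g \<star> (f \<cdot>\<^sub>v X) \<star> Z = (\<lambda>p. f p * (g \<star> X \<star> Z) p)"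
  using metric by (simp add: riemannian_metric_def on_field_def fun_eq_iff vscale_def vfields_tangent)

lemma metric_uminus_left:
  "X \<in> vfields A \<Longrightarrow> Z \<in> vfields A \<Longrightarrow> g \<star> (- X) \<star> Z = - (g \<star> X \<star> Z)"
  using metric_vscale_left[of X Z "\<lambda>p. -1"] by (simp add: vscale_uminus_one) (simp add: fun_eq_iff)

lemma metric_diff_left:
  "X \<in> vfields A \<Longrightarrow> Y \<in> vfields A \<Longrightarrow> Z \<in> vfields A \<Longrightarrow> g \<star> (X - Y) \<star> Z = g \<star> X \<star> Z - g \<star> Y \<star> Z"
  using metric_add_left[of X "- Y" Z] by (simp add: metric_uminus_left)

lemma metric_zero_left: "Z \<in> vfields A \<Longrightarrow> g \<star> 0 \<star> Z = 0"
  using metric_diff_left[of 0 0 Z] by simp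

lemmas metric_left = metric_add_left metric_vscale_left metric_uminus_left metric_diff_left
  metric_zero_left

lemma metric_right:
  assumes "X \<in> vfields A" "Y \<in> vfields A" "Z \<in> vfields A"
  shows "g \<star> Z \<star> (X + Y) = g \<star> Z \<star> X + g \<star> Z \<star> Y"
    and "g \<star> Z \<star> (X - Y) = g \<star> Z \<star> X - g \<star> Z \<star> Y"
    and "g \<star> Z \<star> (- X) = - (g \<star> Z \<star> X)"
    and "smooth_fun A f \<Longrightarrow> g \<star> Z \<star> (f \<cdot>\<^sub>v X) = (\<lambda>p. f p * (g \<star> Z \<star> X) p)"
    and "g \<star> Z \<star> 0 = 0"
  using assms metric_sym[of Z] by (simp_all add: metric_left)

text \<open>Global fields suffice to detect zero because \<open>X\<close> itself serves as test field.\<close>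

lemma metric_nondegenerate:
  assumes X: "X \<in> vfields A" and orth: "\<And>Z. Z \<in> vfields A \<Longrightarrow> g \<star> X \<star> Z = 0"
  shows "X = 0"
proof
  fix p
  have "g p (X p) (X p) = 0"
    using orth[OF X] by (metis on_field_def zero_fun_apply)
  then show "X p = 0 p"
    using metric vfields_tangent[OF X, of p] by (force simp: riemannian_metric_def)
qed

lemma nabla_closed [simp]: "X \<in> vfields A \<Longrightarrow> Y \<in> vfields A \<Longrightarrow> nabla X Y \<in> vfields A"
  using linear_connection_nabla by (simp add: linear_connection_def)

lemma bracket_nabla:
  assumes "X \<in> vfields A" "Y \<in> vfields A"
  shows "bracket X Y = nabla X Y - nabla Y X"
proof -
  have "torsion nabla X Y = 0"
    using levi_civita assms by (simp add: levi_civita_def)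
  then show ?thesis
    by (simp add: torsion_def fun_eq_iff vscale_def tscale_def)
qed

lemma dirderiv_metric:
  "X \<in> vfields A \<Longrightarrow> Y \<in> vfields A \<Longrightarrow> Z \<in> vfields A \<Longrightarrow>
    dirderiv X (g \<star> Y \<star> Z) = g \<star> nabla X Y \<star> Z + g \<star> Y \<star> nabla X Z"
  using levi_civita by (simp add: levi_civita_def)

end

section \<open>The shape operator of an almost Kenmotsu manifold\<close>

locale almost_kenmotsu_manifold = riemannian_manifold A g nabla
  for A :: "('m::{t2_space,second_countable_topology}, 'e::euclidean_space) atlas"
    and g and nabla +
  fixes \<alpha> :: real
    and \<phi> :: "'m \<Rightarrow> 'm tvec \<Rightarrow> 'm tvec"
    and \<xi> :: "'m vfield"
    and \<eta> :: "'m \<Rightarrow> 'm tvec \<Rightarrow> real"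
  assumes alpha_pos: "\<alpha> > 0"
    and almost_kenmotsu: "almost_kenmotsu A \<alpha> \<phi> \<xi> \<eta> g"
begin

lemma almost_contact_metric: "almost_contact_metric A \<phi> \<xi> \<eta> g"
  using almost_kenmotsu by (simp add: almost_kenmotsu_def)

lemma xi_vfield [simp]: "\<xi> \<in> vfields A"
  using almost_contact_metric by (simp add: almost_contact_metric_def)

lemma field_linear_phi: "field_linear A (\<lambda>X. \<phi> \<star> X)"
  using almost_contact_metric by (intro field_linear_endo_field) (simp add: almost_contact_metric_def)

lemma phi_closed [simp]: "X \<in> vfields A \<Longrightarrow> \<phi> \<star> X \<in> vfields A"
  using field_linear_phi by (simp add: field_linear_def)

lemma phi_diff: "X \<in> vfields A \<Longrightarrow> Y \<in> vfields A \<Longrightarrow> \<phi> \<star> (X - Y) = \<phi> \<star> X - \<phi> \<star> Y"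
  by (rule field_linear_diff[OF manifold field_linear_phi])

lemma eta_smooth [simp]: "X \<in> vfields A \<Longrightarrow> smooth_fun A (\<eta> \<star> X)"
  using almost_contact_metric by (simp add: almost_contact_metric_def one_form_def)

lemma phi_phi: "X \<in> vfields A \<Longrightarrow> \<phi> \<star> (\<phi> \<star> X) = - X + (\<eta> \<star> X) \<cdot>\<^sub>v \<xi>"
  using almost_contact_metric
  by (simp add: almost_contact_metric_def on_field_def vscale_def vfields_tangent fun_eq_iff)

lemma phi_xi: "\<phi> \<star> \<xi> = 0"
  using almost_contact_metric by (simp add: almost_contact_metric_def on_field_def fun_eq_iff)

lemma eta_xi: "\<eta> \<star> \<xi> = (\<lambda>p. 1)"
  using almost_contact_metric by (simp add: almost_contact_metric_def on_field_def)

lemma eta_phi: "X \<in> vfields A \<Longrightarrow> \<eta> \<star> (\<phi> \<star> X) = 0"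
  using almost_contact_metric
  by (simp add: almost_contact_metric_def on_field_def vfields_tangent fun_eq_iff)

lemma metric_phi_phi:
  "X \<in> vfields A \<Longrightarrow> Y \<in> vfields A \<Longrightarrow>
    g \<star> (\<phi> \<star> X) \<star> (\<phi> \<star> Y) = (\<lambda>p. (g \<star> X \<star> Y) p - (\<eta> \<star> X) p * (\<eta> \<star> Y) p)"
  using almost_contact_metric
  by (simp add: almost_contact_metric_def on_field_def vfields_tangent fun_eq_iff)

text \<open>Compatibility of \<open>g\<close> with \<open>\<phi>\<close> at \<open>\<phi> \<xi> = 0\<close> shows that \<open>\<eta>\<close> is metrically dual to \<open>\<xi>\<close>.\<close>

lemma metric_xi:
  assumes "X \<in> vfields A"
  shows "g \<star> X \<star> \<xi> = \<eta> \<star> X" "g \<star> \<xi> \<star> X = \<eta> \<star> X"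
proof -
  show "g \<star> X \<star> \<xi> = \<eta> \<star> X"
    using metric_phi_phi[OF assms xi_vfield] assms metric_right(5)[of 0 0 "\<phi> \<star> X"]
    by (simp add: phi_xi eta_xi fun_eq_iff)
  then show "g \<star> \<xi> \<star> X = \<eta> \<star> X"
    using metric_sym assms by simp
qed

lemma eta_linear:
  assumes "X \<in> vfields A" "Y \<in> vfields A"
  shows "\<eta> \<star> (X + Y) = \<eta> \<star> X + \<eta> \<star> Y"
    and "\<eta> \<star> (X - Y) = \<eta> \<star> X - \<eta> \<star> Y"
    and "\<eta> \<star> (- X) = - (\<eta> \<star> X)"
    and "smooth_fun A f \<Longrightarrow> \<eta> \<star> (f \<cdot>\<^sub>v X) = (\<lambda>p. f p * (\<eta> \<star> X) p)"
  using assms by (simp_all add: metric_xi(1)[symmetric] metric_left)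

text \<open>Replace \<open>X\<close> by \<open>\<phi> X\<close> in the compatibility of \<open>g\<close> with \<open>\<phi>\<close>.\<close>

lemma metric_phi_skew:
  assumes X: "X \<in> vfields A" and Y: "Y \<in> vfields A"
  shows "g \<star> (\<phi> \<star> X) \<star> Y = - (g \<star> X \<star> (\<phi> \<star> Y))"
  using metric_phi_phi[of "\<phi> \<star> X" Y] X Y
  by (simp add: phi_phi eta_phi metric_left metric_xi fun_eq_iff)

lemma field_linear_shape: "field_linear A (\<lambda>X. nabla X \<xi>)"
  by (rule linear_connection_field_linear[OF linear_connection_nabla xi_vfield])

lemma shape_linear:
  assumes "X \<in> vfields A" "Y \<in> vfields A"
  shows "nabla (X + Y) \<xi> = nabla X \<xi> + nabla Y \<xi>"
    and "nabla (X - Y) \<xi> = nabla X \<xi> - nabla Y \<xi>"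
    and "smooth_fun A f \<Longrightarrow> nabla (f \<cdot>\<^sub>v X) \<xi> = f \<cdot>\<^sub>v nabla X \<xi>"
  using assms field_linear_shape field_linear_diff[OF manifold field_linear_shape]
  by (simp_all add: field_linear_def)

text \<open>This is \<open>d\<eta> = 0\<close>: the terms of \<open>d\<eta>(X, Y)\<close> in which \<open>Y\<close> or \<open>X\<close> is differentiated cancel against
  the bracket, and only the derivatives of \<open>\<xi>\<close> remain.\<close>

lemma shape_symmetric:
  assumes X: "X \<in> vfields A" and Y: "Y \<in> vfields A"
  shows "g \<star> nabla X \<xi> \<star> Y = g \<star> nabla Y \<xi> \<star> X"
proof -
  have "ext_d1 \<eta> X Y = 0"
    using almost_kenmotsu X Y by (simp add: almost_kenmotsu_def)
  then have "dirderiv X (g \<star> Y \<star> \<xi>) - dirderiv Y (g \<star> X \<star> \<xi>)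
      - g \<star> (nabla X Y - nabla Y X) \<star> \<xi> = 0"
    using X Y by (simp add: ext_d1_def metric_xi bracket_nabla)
  then show ?thesis
    using X Y metric_sym[of Y "nabla X \<xi>"] metric_sym[of X "nabla Y \<xi>"]
    by (simp add: dirderiv_metric metric_left fun_eq_iff)
qed

text \<open>Differentiate \<open>g(\<xi>, \<xi>) = 1\<close>.\<close>

lemma eta_shape:
  assumes X: "X \<in> vfields A"
  shows "\<eta> \<star> nabla X \<xi> = 0"
proof -
  have "dirderiv X (g \<star> \<xi> \<star> \<xi>) = 0"
    using X by (simp add: metric_xi eta_xi dirderiv_const)
  then have "g \<star> nabla X \<xi> \<star> \<xi> + g \<star> \<xi> \<star> nabla X \<xi> = 0"
    using dirderiv_metric[OF X xi_vfield xi_vfield] by simp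
  then show ?thesis
    using X by (simp add: metric_xi fun_eq_iff)
qed

lemma shape_xi: "nabla \<xi> \<xi> = 0"
proof (rule metric_nondegenerate)
  fix Z assume "Z \<in> vfields A"
  then show "g \<star> nabla \<xi> \<xi> \<star> Z = 0"
    using shape_symmetric[of \<xi> Z] by (simp add: metric_xi eta_shape)
qed simp

text \<open>With \<open>B X = \<nabla>\<^sub>X \<xi>\<close>, the identity \<open>d\<Phi>(\<xi>, Y, Z) = 2\<alpha> \<Phi>(Y, Z)\<close> says that the Lie derivative of
  \<open>\<Phi>\<close> along \<open>\<xi>\<close> is \<open>2\<alpha> \<Phi>\<close>. Of its value at \<open>(Y, Z)\<close> the metric contributes \<open>2 g(Y, B \<phi> Z)\<close>, so \<open>\<phi>\<close>
  contributes the rest.\<close>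

lemma lie_deriv_phi:
  assumes Z: "Z \<in> vfields A"
  shows "lie_deriv_endo \<xi> \<phi> Z
    = (\<lambda>p. 2 * \<alpha>) \<cdot>\<^sub>v (\<phi> \<star> Z) - (\<lambda>p. 2) \<cdot>\<^sub>v nabla (\<phi> \<star> Z) \<xi>" (is "?L = ?R")
proof -
  have L: "?L = nabla \<xi> (\<phi> \<star> Z) - nabla (\<phi> \<star> Z) \<xi> - \<phi> \<star> (nabla \<xi> Z - nabla Z \<xi>)"
    using Z by (simp add: lie_deriv_endo_def bracket_nabla)
  have "?L - ?R = 0"
  proof (rule metric_nondegenerate)
    show "?L - ?R \<in> vfields A" using Z by (simp add: L)
    fix Y assume Y: "Y \<in> vfields A"
    have "ext_d2 (fundamental_form \<phi> g) \<xi> Y Z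
        = (\<lambda>p. 2 * \<alpha> * wedge12 \<eta> (fundamental_form \<phi> g) \<xi> Y Z p)"
      using almost_kenmotsu Y Z by (simp add: almost_kenmotsu_def)
    \<comment> \<open>All other terms contain \<open>\<phi> \<xi>\<close> or \<open>\<eta> \<circ> \<phi>\<close>.\<close>
    then have "dirderiv \<xi> (g \<star> Y \<star> (\<phi> \<star> Z)) - g \<star> (nabla \<xi> Y - nabla Y \<xi>) \<star> (\<phi> \<star> Z)
        - g \<star> (nabla Z \<xi> - nabla \<xi> Z) \<star> (\<phi> \<star> Y) = (\<lambda>p. 2 * \<alpha> * (g \<star> Y \<star> (\<phi> \<star> Z)) p)"
      using Y Z metric_right(5)[of 0 0]
      by (simp add: ext_d2_def wedge12_def fundamental_form_def phi_xi metric_xi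
          eta_phi eta_xi bracket_nabla dirderiv_zero)
    moreover have "g \<star> nabla Y \<xi> \<star> (\<phi> \<star> Z) = g \<star> nabla (\<phi> \<star> Z) \<xi> \<star> Y"
      using Y Z by (intro shape_symmetric) simp_all
    moreover have "g \<star> W \<star> (\<phi> \<star> Y) = - (g \<star> (\<phi> \<star> W) \<star> Y)" if "W \<in> vfields A" for W
      using metric_phi_skew[OF that Y] by simp
    ultimately show "g \<star> (?L - ?R) \<star> Y = 0"
      using Y Z metric_sym[OF Y, of "nabla \<xi> (\<phi> \<star> Z)"] metric_sym[OF Y, of "\<phi> \<star> Z"]
        metric_sym[of "\<phi> \<star> Z" "nabla \<xi> Y"]
      by (simp add: L dirderiv_metric metric_left phi_diff fun_eq_iff algebra_simps)
  qed
  then show ?thesis by simp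
qed

abbreviation "h' \<equiv> h_prime \<alpha> \<phi> \<xi>"

text \<open>Since \<open>B X = \<nabla>\<^sub>X \<xi>\<close> annihilates \<open>\<xi>\<close>, it satisfies \<open>B \<phi>\<^sup>2 = - B\<close>, and composing the Lie
  derivative of \<open>\<phi>\<close> with \<open>\<phi>\<close> gives \<open>2\<alpha> \<phi>\<^sup>2 + 2 B\<close>.\<close>

lemma h_prime_shape:
  assumes X: "X \<in> vfields A"
  shows "h' X = (\<lambda>p. 1 / \<alpha>) \<cdot>\<^sub>v nabla X \<xi> - X + (\<eta> \<star> X) \<cdot>\<^sub>v \<xi>"
proof -
  have "nabla (\<phi> \<star> (\<phi> \<star> X)) \<xi> = - nabla X \<xi>"
    using X by (simp add: phi_phi shape_linear shape_xi)
      (simp add: fun_eq_iff vscale_def tscale_def)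
  then have "lie_deriv_endo \<xi> \<phi> (\<phi> \<star> X)
      = (\<lambda>p. 2 * \<alpha>) \<cdot>\<^sub>v (- X + (\<eta> \<star> X) \<cdot>\<^sub>v \<xi>) + (\<lambda>p. 2) \<cdot>\<^sub>v nabla X \<xi>"
    using X by (simp add: lie_deriv_phi phi_phi) (simp add: fun_eq_iff vscale_def tscale_def)
  then show ?thesis
    using alpha_pos unfolding h_prime_def
    by (simp add: fun_eq_iff vscale_def tscale_def field_simps)
qed

lemma h_prime_closed [simp]: "X \<in> vfields A \<Longrightarrow> h' X \<in> vfields A"
  by (simp add: h_prime_shape)

lemma field_linear_h_prime: "field_linear A h'"
  unfolding field_linear_def
  by (auto simp: h_prime_shape shape_linear eta_linear)
    (auto simp: fun_eq_iff vscale_def tscale_def algebra_simps)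

lemma h_prime_linear:
  assumes "X \<in> vfields A" "Y \<in> vfields A"
  shows "h' (X + Y) = h' X + h' Y"
    and "h' (X - Y) = h' X - h' Y"
    and "smooth_fun A f \<Longrightarrow> h' (f \<cdot>\<^sub>v X) = f \<cdot>\<^sub>v h' X"
  using assms field_linear_h_prime field_linear_diff[OF manifold field_linear_h_prime]
  by (simp_all add: field_linear_def)

lemma h_prime_symmetric:
  assumes "X \<in> vfields A" "Y \<in> vfields A"
  shows "g \<star> h' X \<star> Y = g \<star> h' Y \<star> X"
  using assms shape_symmetric[OF assms] metric_sym[OF assms]
  by (simp add: h_prime_shape metric_left metric_xi fun_eq_iff)

lemma h_prime_xi: "h' \<xi> = 0"
  by (simp add: h_prime_shape shape_xi eta_xi) (simp add: fun_eq_iff vscale_def tscale_def)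

text \<open>By symmetry \<open>\<eta>(h' X) = g(h' X, \<xi>) = g(h' \<xi>, X)\<close>.\<close>

lemma eta_h_prime:
  assumes "X \<in> vfields A"
  shows "\<eta> \<star> h' X = 0"
  using h_prime_symmetric[OF assms xi_vfield] assms
  by (simp add: h_prime_xi metric_xi metric_left)

section \<open>The canonical connection\<close>

abbreviation "nabla_can \<equiv> canonical_connection \<alpha> \<phi> \<xi> \<eta> g nabla"

abbreviation "K \<equiv> \<lambda>X. X + h' X"

lemma nabla_can_closed [simp]:
  "X \<in> vfields A \<Longrightarrow> Y \<in> vfields A \<Longrightarrow> nabla_can X Y \<in> vfields A"
  by (simp add: canonical_connection_def)

lemma linear_connection_nabla_can: "linear_connection A nabla_can"
  using linear_connection_nabla
  unfolding linear_connection_def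
  by (auto simp: canonical_connection_def h_prime_linear metric_left metric_right eta_linear)
    (auto simp: fun_eq_iff vscale_def tscale_def algebra_simps)

text \<open>The correction terms are chosen for this: by \<open>h_prime_shape\<close>, \<open>\<alpha> K X\<close> equals \<open>\<nabla>\<^sub>X \<xi>\<close> up to the
  component \<open>\<alpha> \<eta>(X) \<xi>\<close>, which is what the other correction term contributes for \<open>Y = \<xi>\<close>.\<close>

lemma nabla_can_xi:
  assumes X: "X \<in> vfields A"
  shows "nabla_can X \<xi> = 0"
  using X alpha_pos
  by (simp add: canonical_connection_def eta_linear metric_xi eta_h_prime eta_xi)
    (simp add: h_prime_shape fun_eq_iff vscale_def tscale_def field_simps)

text \<open>The correction \<open>Y \<mapsto> \<alpha> g(K X, Y) \<xi> - \<alpha> \<eta>(Y) K X\<close> is skew-symmetric, so metricity is inherited from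
  the Levi-Civita connection.\<close>

lemma nabla_can_metric:
  assumes "X \<in> vfields A" "Y \<in> vfields A" "Z \<in> vfields A"
  shows "dirderiv X (g \<star> Y \<star> Z) = g \<star> nabla_can X Y \<star> Z + g \<star> Y \<star> nabla_can X Z"
  using assms metric_sym[of Y "K X"]
  by (simp add: canonical_connection_def dirderiv_metric metric_left metric_right metric_xi)
    (simp add: fun_eq_iff algebra_simps)

lemma eta_nabla_can:
  assumes "X \<in> vfields A" "Y \<in> vfields A"
  shows "\<eta> \<star> nabla_can X Y = dirderiv X (\<eta> \<star> Y)"
  using nabla_can_metric[OF assms xi_vfield] assms metric_right(5)[of 0 0 Y]
  by (simp add: metric_xi nabla_can_xi)

text \<open>The components along \<open>\<xi>\<close> cancel because \<open>K\<close> is symmetric.\<close>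

lemma torsion_nabla_can:
  assumes "Y \<in> vfields A" "Z \<in> vfields A"
  shows "torsion nabla_can Y Z
    = (\<lambda>p. \<alpha> / 2) \<cdot>\<^sub>v ((\<eta> \<star> Y) \<cdot>\<^sub>v K Z - (\<eta> \<star> Z) \<cdot>\<^sub>v K Y)"
  using assms h_prime_symmetric[OF assms] metric_sym[OF assms]
  by (simp add: torsion_def canonical_connection_def bracket_nabla metric_left)
    (simp add: fun_eq_iff vscale_def tscale_def algebra_simps)

text \<open>The torsion is built from \<open>\<eta>\<close>, the identity and \<open>h'\<close>, and the first two are parallel for the
  canonical connection.\<close>

lemma cov_deriv_torsion_nabla_can:
  assumes X: "X \<in> vfields A" and Y: "Y \<in> vfields A" and Z: "Z \<in> vfields A"
  shows "cov_deriv_bilin nabla_can (torsion nabla_can) X Y Z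
    = (\<lambda>p. \<alpha> / 2) \<cdot>\<^sub>v ((\<eta> \<star> Y) \<cdot>\<^sub>v cov_deriv_endo nabla_can h' X Z
        - (\<eta> \<star> Z) \<cdot>\<^sub>v cov_deriv_endo nabla_can h' X Y)"
proof -
  note D = linear_connection_nabla_can
  have diff: "nabla_can X (V - W) = nabla_can X V - nabla_can X W"
    if "V \<in> vfields A" "W \<in> vfields A" for V W
    by (rule linear_connection_diff_right[OF manifold D X that])
  have add: "nabla_can X (V + W) = nabla_can X V + nabla_can X W"
    and leibniz: "smooth_fun A f \<Longrightarrow>
      nabla_can X (f \<cdot>\<^sub>v V) = dirderiv X f \<cdot>\<^sub>v V + f \<cdot>\<^sub>v nabla_can X V"
    if "V \<in> vfields A" "W \<in> vfields A" for V W f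
    using D X that by (simp_all add: linear_connection_def)
  show ?thesis
    using assms
    by (simp add: cov_deriv_bilin_def cov_deriv_endo_def torsion_nabla_can diff add leibniz
        dirderiv_const eta_nabla_can)
      (simp add: fun_eq_iff vscale_def tscale_def algebra_simps)
qed

lemma cov_deriv_h_prime_can:
  assumes X: "X \<in> vfields A" and Y: "Y \<in> vfields A"
  shows "cov_deriv_endo nabla_can h' X Y = cov_deriv_endo nabla h' X Y
    + (\<lambda>p. \<alpha> * (g \<star> K X \<star> h' Y) p) \<cdot>\<^sub>v \<xi> + (\<lambda>p. \<alpha> * (\<eta> \<star> Y) p) \<cdot>\<^sub>v h' (K X)"
  using assms
  by (simp add: cov_deriv_endo_def canonical_connection_def h_prime_linear h_prime_xi eta_h_prime)
    (simp add: fun_eq_iff vscale_def tscale_def algebra_simps)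

lemma cov_deriv_h_prime_can_xi_right:
  assumes "X \<in> vfields A"
  shows "cov_deriv_endo nabla_can h' X \<xi> = 0"
proof -
  have "nabla_can X 0 = 0"
    using linear_connection_diff_right[OF manifold linear_connection_nabla_can assms, of 0 0]
    by simp
  moreover have "h' 0 = 0"
    using h_prime_linear(2)[of 0 0] by simp
  ultimately show ?thesis
    using assms by (simp add: cov_deriv_endo_def h_prime_xi nabla_can_xi)
qed

lemma cov_deriv_h_prime_can_xi_left:
  assumes "Y \<in> vfields A"
  shows "cov_deriv_endo nabla_can h' \<xi> Y = cov_deriv_endo nabla h' \<xi> Y"
  using assms
  by (simp add: cov_deriv_h_prime_can h_prime_xi metric_xi eta_h_prime)
    (simp add: fun_eq_iff vscale_def tscale_def)

lemma cov_deriv_h_prime_can_closed [simp]: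
  "X \<in> vfields A \<Longrightarrow> Y \<in> vfields A \<Longrightarrow> cov_deriv_endo nabla_can h' X Y \<in> vfields A"
  by (simp add: cov_deriv_endo_def)

text \<open>The canonical connection preserves \<open>\<eta>\<close>, hence \<open>ker \<eta>\<close>, and \<open>h'\<close> takes values there.\<close>

lemma eta_cov_deriv_h_prime_can:
  assumes "X \<in> vfields A" "Y \<in> vfields A"
  shows "\<eta> \<star> cov_deriv_endo nabla_can h' X Y = 0"
  using assms by (simp add: cov_deriv_endo_def eta_linear eta_nabla_can eta_h_prime dirderiv_zero)

text \<open>The difference of the two covariant derivatives consists of a multiple of \<open>\<xi>\<close>, orthogonal to \<open>Z\<close>,
  and a term with the factor \<open>\<eta>(Y)\<close>.\<close>

lemma metric_cov_deriv_h_prime_can: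
  assumes "X \<in> vfields A" "Y \<in> vfields A" "Z \<in> vfields A" "\<eta> \<star> Y = 0" "\<eta> \<star> Z = 0"
  shows "g \<star> cov_deriv_endo nabla_can h' X Y \<star> Z = g \<star> cov_deriv_endo nabla h' X Y \<star> Z"
proof -
  have "cov_deriv_endo nabla h' X Y \<in> vfields A"
    using assms by (simp add: cov_deriv_endo_def)
  then show ?thesis
    using assms
    by (simp add: cov_deriv_h_prime_can metric_left metric_xi) (simp add: fun_eq_iff)
qed

definition horizontal :: "'m vfield \<Rightarrow> 'm vfield" where
  "horizontal X = X - (\<eta> \<star> X) \<cdot>\<^sub>v \<xi>"

lemma horizontal_closed [simp]: "X \<in> vfields A \<Longrightarrow> horizontal X \<in> vfields A"
  by (simp add: horizontal_def)

lemma eta_horizontal: "X \<in> vfields A \<Longrightarrow> \<eta> \<star> horizontal X = 0"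
  by (simp add: horizontal_def eta_linear eta_xi fun_eq_iff)

lemma field_linear_horizontal:
  assumes "field_linear A S" "X \<in> vfields A" "S \<xi> = 0"
  shows "S (horizontal X) = S X"
proof -
  have "S ((\<eta> \<star> X) \<cdot>\<^sub>v \<xi>) = (\<eta> \<star> X) \<cdot>\<^sub>v S \<xi>"
    using assms by (simp add: field_linear_def)
  then show ?thesis
    using assms field_linear_diff[OF manifold assms(1,2), of "(\<eta> \<star> X) \<cdot>\<^sub>v \<xi>"]
    by (simp add: horizontal_def) (simp add: fun_eq_iff vscale_def tscale_def)
qed

text \<open>From parallel torsion the derivative of \<open>h'\<close> is recovered by inserting \<open>\<xi>\<close> into the first torsion
  argument, where \<open>\<eta>(\<xi>) = 1\<close> and the second term drops out with \<open>(D\<^sub>X h') \<xi> = 0\<close>.\<close>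

lemma parallel_torsion_iff_parallel_h_prime:
  "parallel_bilin A nabla_can (torsion nabla_can) \<longleftrightarrow> parallel_endo A nabla_can h'"
proof
  assume parallel: "parallel_bilin A nabla_can (torsion nabla_can)"
  show "parallel_endo A nabla_can h'"
    unfolding parallel_endo_def
  proof (intro ballI)
    fix X Z assume XZ: "X \<in> vfields A" "Z \<in> vfields A"
    have "cov_deriv_bilin nabla_can (torsion nabla_can) X \<xi> Z = 0"
      using parallel XZ by (simp add: parallel_bilin_def)
    then show "cov_deriv_endo nabla_can h' X Z = 0"
      using XZ alpha_pos
      by (simp add: cov_deriv_torsion_nabla_can eta_xi cov_deriv_h_prime_can_xi_right)
        (simp add: fun_eq_iff vscale_def tscale_def)
  qed
next
  assume "parallel_endo A nabla_can h'"
  then show "parallel_bilin A nabla_can (torsion nabla_can)"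
    by (simp add: parallel_endo_def parallel_bilin_def cov_deriv_torsion_nabla_can)
      (simp add: fun_eq_iff vscale_def tscale_def)
qed

text \<open>For the converse, \<open>\<eta>\<close>-parallelism only controls arguments orthogonal to \<open>\<xi>\<close>. Each argument is
  therefore replaced by its horizontal part: in the direction of differentiation this costs
  \<open>D\<^sub>\<xi> h' = \<nabla>\<^sub>\<xi> h' = 0\<close>, in the argument of \<open>h'\<close> it costs \<open>(D\<^sub>X h') \<xi> = 0\<close>, and in the test field it
  costs \<open>\<eta>((D\<^sub>X h') Y) = 0\<close>.\<close>

lemma parallel_h_prime_iff_eta_parallel:
  "parallel_endo A nabla_can h' \<longleftrightarrow>
    eta_parallel A g \<xi> nabla h' \<and> (\<forall>Y\<in>vfields A. cov_deriv_endo nabla h' \<xi> Y = 0)"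
proof
  assume parallel: "parallel_endo A nabla_can h'"
  then have "eta_parallel A g \<xi> nabla h'"
    by (auto simp: eta_parallel_def parallel_endo_def metric_xi metric_left
        metric_cov_deriv_h_prime_can[symmetric])
  then show "eta_parallel A g \<xi> nabla h' \<and> (\<forall>Y\<in>vfields A. cov_deriv_endo nabla h' \<xi> Y = 0)"
    using parallel by (simp add: parallel_endo_def cov_deriv_h_prime_can_xi_left[symmetric])
next
  assume c: "eta_parallel A g \<xi> nabla h' \<and> (\<forall>Y\<in>vfields A. cov_deriv_endo nabla h' \<xi> Y = 0)"
  let ?S = "cov_deriv_endo nabla_can h'"
  note lin =
    field_linear_cov_deriv_direction
      [OF manifold linear_connection_nabla_can field_linear_h_prime]
    field_linear_cov_deriv_endo
      [OF manifold linear_connection_nabla_can field_linear_h_prime]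
  show "parallel_endo A nabla_can h'"
    unfolding parallel_endo_def
  proof (intro ballI)
    fix X Y assume X: "X \<in> vfields A" and Y: "Y \<in> vfields A"
    show "?S X Y = 0"
    proof (rule metric_nondegenerate)
      fix Z assume Z: "Z \<in> vfields A"
      have "?S (horizontal X) (horizontal Y) = ?S (horizontal X) Y"
        using X Y by (intro field_linear_horizontal[OF lin(2)])
          (simp_all add: cov_deriv_h_prime_can_xi_right)
      also have "\<dots> = ?S X Y"
        using X Y c by (intro field_linear_horizontal[OF lin(1)])
          (simp_all add: cov_deriv_h_prime_can_xi_left)
      finally have "g \<star> ?S X Y \<star> horizontal Z
          = g \<star> cov_deriv_endo nabla h' (horizontal X) (horizontal Y) \<star> horizontal Z"
        using metric_cov_deriv_h_prime_can[of "horizontal X" "horizontal Y" "horizontal Z"] X Y Z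
        by (simp add: eta_horizontal)
      also have "\<dots> = 0"
        using c X Y Z by (simp add: eta_parallel_def metric_xi eta_horizontal)
      finally show "g \<star> ?S X Y \<star> Z = 0"
        using X Y Z
        by (simp add: horizontal_def metric_right metric_xi eta_cov_deriv_h_prime_can fun_eq_iff)
    qed (use X Y in simp)
  qed
qed

end

theorem lemma1:
  fixes A :: "('m::{t2_space,second_countable_topology}, 'e::euclidean_space) atlas"
    and n :: nat
    and \<alpha> :: real
    and \<phi> :: "'m \<Rightarrow> 'm tvec \<Rightarrow> 'm tvec"
    and \<xi> :: "'m vfield"
    and \<eta> :: "'m \<Rightarrow> 'm tvec \<Rightarrow> real"
    and g :: "'m \<Rightarrow> 'm tvec \<Rightarrow> 'm tvec \<Rightarrow> real"
    and nabla :: "'m connection"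
  defines "h' \<equiv> h_prime \<alpha> \<phi> \<xi>"
    and "nabla_can \<equiv> canonical_connection \<alpha> \<phi> \<xi> \<eta> g nabla"
  assumes "smooth_manifold A" and "DIM('e) = 2 * n + 1"
    and "\<alpha> > 0"
    and "almost_kenmotsu A \<alpha> \<phi> \<xi> \<eta> g"
    and "CR_integrable A \<phi> \<eta>"
    and "levi_civita A g nabla"
  shows "(parallel_bilin A nabla_can (torsion nabla_can) \<longleftrightarrow> parallel_endo A nabla_can h') \<and>
    (parallel_endo A nabla_can h' \<longleftrightarrow>
      eta_parallel A g \<xi> nabla h' \<and> (\<forall>Y\<in>vfields A. cov_deriv_endo nabla h' \<xi> Y = 0))"
proof -
  interpret almost_kenmotsu_manifold A g nabla \<alpha> \<phi> \<xi> \<eta>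
    using assms
    by unfold_locales (simp_all add: almost_kenmotsu_def almost_contact_metric_def)
  show ?thesis
    unfolding h'_def nabla_can_def
    using parallel_torsion_iff_parallel_h_prime parallel_h_prime_iff_eta_parallel by blast
qed

end
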